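(* There is an absolute constant $C>0$ such that for every integer $r\ge 2$ and every $n\ge 1$ the following holds: if the edges of the complete graph $K_n$ are $r$-locally coloured, then the vertex set of $K_n$ can be partitioned into at most $C r^2\log r$ vertex-disjoint monochromatic cycles. (In the paper's words: the vertex set of any $r$-locally coloured complete graph may be partitioned into $O(r^2\log r)$ disjoint monochromatic cycles.)
   Context: An edge colouring of a graph is an $r$-local colouring if the edges incident to any vertex are coloured with at most $r$ colours; the total number of colours used is not restricted. A cycle is monochromatic if all its edges have the same colour. By convention, a single vertex and a single edge are also considered to be (monochromatic) cycles. *)

theory Defs
  imports Complex_Main
begin

text \<open>Complete graph K_n on vertex set {..<n}; an edge colouring assigns a colour
  (a natural number) to every two-element set {u,v}.\<close>

definition r_local_colouring :: "nat \<Rightarrow> nat \<Rightarrow> (nat set \<Rightarrow> nat) \<Rightarrow> bool" where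
  "r_local_colouring r n c \<longleftrightarrow>
     (\<forall>v<n. card ((\<lambda>w. c {v, w}) ` ({..<n} - {v})) \<le> r)"

text \<open>A monochromatic cycle in K_n, given by its cyclic vertex sequence: a nonempty
  list of distinct vertices; a single vertex and a single edge count as cycles; for
  length \<ge> 2 all edges between cyclically consecutive vertices have the same colour.\<close>

definition mono_cycle :: "nat \<Rightarrow> (nat set \<Rightarrow> nat) \<Rightarrow> nat list \<Rightarrow> bool" where
  "mono_cycle n c xs \<longleftrightarrow>
     xs \<noteq> [] \<and> distinct xs \<and> set xs \<subseteq> {..<n} \<and>
     (\<exists>col. \<forall>i<length xs. length xs \<ge> 2 \<longrightarrow>
        c {xs ! i, xs ! ((i + 1) mod length xs)} = col)"

definition mono_cycle_partition :: "nat \<Rightarrow> (nat set \<Rightarrow> nat) \<Rightarrow> nat list list \<Rightarrow> bool" where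
  "mono_cycle_partition n c P \<longleftrightarrow>
     (\<forall>xs\<in>set P. mono_cycle n c xs) \<and> distinct (concat P) \<and> set (concat P) = {..<n}"

end

theory Submission
  imports Defs
begin

text \<open>
  The Erdos-Gyarfas-Pyber absorption method. A set of \<open>R = (r + 2)\<^sup>r\<^sup>+\<^sup>1\<close> vertices always
  contains a monochromatic triangle, so by double counting some colour has many more triangles than
  \<open>k = n / R\<^sup>3\<close> times its number of edges. Deleting edges of low codegree leaves a triangle system
  in which a longest tight path closes up to a cycle; every second vertex of this cycle may be omitted
  at will, giving a reservoir \<open>B\<close> of at least \<open>n / (4 R\<^sup>3)\<close> vertices. Outside the cycle, one repeatedly
  removes a monochromatic cycle through a \<open>1 / (2 r)\<close> fraction of the remaining vertices: some
  colour has average degree at least \<open>(n - 1) / r\<close> on the vertices that see it, because each vertex sees at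
  most \<open>r\<close> colours. After \<open>O(r\<^sup>2 log r)\<close> steps at most \<open>|B| / (4 r\<^sup>2)\<close> vertices are left,
  and these are covered by \<open>2 r\<^sup>2\<close> cycles that use only vertices of \<open>B\<close> besides them.
\<close>

section \<open>Cycles, covers and longest paths\<close>

text \<open>Deleting an \<open>s\<close> of degree at most \<open>k\<close> costs at most
  \<open>k\<close> members of \<open>T\<close>, so \<open>k * card S < card T\<close> survives and
  the deletion ends before \<open>T\<close> is empty. It is used for edges inside triangles and for
  vertices inside edges.\<close>

lemma exists_dense_core:
  fixes f :: "'t \<Rightarrow> 's set"
  assumes "finite S" "finite T" "\<And>t. t \<in> T \<Longrightarrow> f t \<subseteq> S" "k * card S < card T"
  shows "\<exists>T'. T' \<subseteq> T \<and> T' \<noteq> {} \<and> (\<forall>t\<in>T'. \<forall>s\<in>f t. k < card {u \<in> T'. s \<in> f u})"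
  using assms
proof (induction "card S" arbitrary: S T)
  case 0
  then have "S = {}" "T \<noteq> {}" by auto
  then show ?case using 0 by (intro exI[of _ T]) auto
next
  case (Suc m)
  show ?case
  proof (cases "\<exists>s\<in>S. card {u \<in> T. s \<in> f u} \<le> k")
    case True
    then obtain s where s: "s \<in> S" "card {u \<in> T. s \<in> f u} \<le> k" by blast
    let ?T = "{u \<in> T. s \<notin> f u}"
    have cS: "card (S - {s}) = m" using Suc s by simp
    have "T = ?T \<union> {u \<in> T. s \<in> f u}" by auto
    then have "card T \<le> card ?T + card {u \<in> T. s \<in> f u}" by (metis card_Un_le)
    then have "card T \<le> card ?T + k" using s by linarith
    moreover have "k * Suc m < card T" using Suc by simp
    ultimately have "k * card (S - {s}) < card ?T" using cS by simp
    then have "\<exists>T'. T' \<subseteq> ?T \<and> T' \<noteq> {} \<and> (\<forall>t\<in>T'. \<forall>s\<in>f t. k < card {u \<in> T'. s \<in> f u})"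
    proof (intro Suc.hyps(1)[of "S - {s}" ?T])
      show "f t \<subseteq> S - {s}" if "t \<in> ?T" for t using Suc.prems(3)[of t] that by auto
    qed (use Suc.prems(1,2) cS in simp_all)
    then obtain T' where "T' \<subseteq> ?T" "T' \<noteq> {}" "\<forall>t\<in>T'. \<forall>s\<in>f t. k < card {u \<in> T'. s \<in> f u}"
      by (elim exE conjE)
    then show ?thesis by (intro exI[of _ T'] conjI) (blast, assumption+)
  next
    case False
    moreover have "T \<noteq> {}" using Suc.prems by auto
    ultimately show ?thesis using Suc.prems(3) by (intro exI[of _ T]) (meson not_le order_refl subsetD)
  qed
qed

lemma exists_longest_list:
  assumes "finite V" "P xs" "\<And>xs. P xs \<Longrightarrow> distinct xs \<and> set xs \<subseteq> V"
  obtains ys where "P ys" "\<And>zs. P zs \<Longrightarrow> length zs \<le> length ys"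
proof -
  have "length ys < Suc (card V)" if "P ys" for ys
    using assms(1) assms(3)[OF that] by (metis card_mono distinct_card le_imp_less_Suc)
  then have "\<exists>ys. P ys \<and> (\<forall>zs. P zs \<longrightarrow> length zs \<le> length ys)"
    using assms(2) by (intro ex_has_greatest_nat[of P xs length "Suc (card V)"]) auto
  then show thesis using that by (elim exE conjE) simp
qed

section \<open>Partitions of vertex sets into cycles\<close>

text \<open>\<open>E\<close> is an arbitrary relation, because the notion serves both colour classes
  and auxiliary graphs. The guard on the closing edge admits single vertices; for symmetric
  \<open>E\<close> a list of two vertices is just an edge.\<close>

definition is_cycle :: "('a \<Rightarrow> 'a \<Rightarrow> bool) \<Rightarrow> 'a list \<Rightarrow> bool" where
  "is_cycle E xs \<longleftrightarrow> xs \<noteq> [] \<and> distinct xs \<and> successively E xs \<and>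
     (length xs \<ge> 2 \<longrightarrow> E (last xs) (hd xs))"

text \<open>The predicate \<open>C\<close> is left open so that the same rules combine monochromatic
  cycles and cycles of auxiliary graphs.\<close>

definition cycle_coverable :: "('a list \<Rightarrow> bool) \<Rightarrow> 'a set \<Rightarrow> nat \<Rightarrow> bool" where
  "cycle_coverable C X k \<longleftrightarrow>
     (\<exists>P. (\<forall>xs\<in>set P. C xs) \<and> distinct (concat P) \<and> set (concat P) = X \<and> length P \<le> k)"

lemma cycle_coverable_empty: "cycle_coverable C {} k"
  unfolding cycle_coverable_def by (intro exI[of _ "[]"]) auto

lemma cycle_coverable_single: "C xs \<Longrightarrow> distinct xs \<Longrightarrow> cycle_coverable C (set xs) 1"
  unfolding cycle_coverable_def by (intro exI[of _ "[xs]"]) auto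

lemma cycle_coverable_mono:
  "cycle_coverable C X k \<Longrightarrow> k \<le> l \<Longrightarrow> (\<And>xs. C xs \<Longrightarrow> D xs) \<Longrightarrow> cycle_coverable D X l"
  unfolding cycle_coverable_def
  by (elim exE, rename_tac P, rule_tac x = P in exI) auto

lemma cycle_coverable_Un:
  assumes "cycle_coverable C X k" "cycle_coverable C Y l" "X \<inter> Y = {}"
  shows "cycle_coverable C (X \<union> Y) (k + l)"
proof -
  obtain P where P: "\<forall>xs\<in>set P. C xs" "distinct (concat P)" "set (concat P) = X" "length P \<le> k"
    using assms(1) unfolding cycle_coverable_def by blast
  obtain Q where Q: "\<forall>xs\<in>set Q. C xs" "distinct (concat Q)" "set (concat Q) = Y" "length Q \<le> l"
    using assms(2) unfolding cycle_coverable_def by blast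
  have "set (concat (P @ Q)) = X \<union> Y" "distinct (concat (P @ Q))"
    using P Q assms(3) by (simp_all only: concat_append set_append distinct_append)
  moreover have "\<forall>xs\<in>set (P @ Q). C xs" "length (P @ Q) \<le> k + l"
    using P Q by auto
  ultimately show ?thesis unfolding cycle_coverable_def by blast
qed

lemma cycle_coverable_UN:
  assumes "finite K" "\<And>i. i \<in> K \<Longrightarrow> cycle_coverable C (X i) (k i)"
    "\<And>i j. i \<in> K \<Longrightarrow> j \<in> K \<Longrightarrow> i \<noteq> j \<Longrightarrow> X i \<inter> X j = {}"
  shows "cycle_coverable C (\<Union>i\<in>K. X i) (\<Sum>i\<in>K. k i)"
  using assms
proof (induction K)
  case empty
  then show ?case by (simp add: cycle_coverable_empty)
next
  case (insert i K)
  have "cycle_coverable C (X i \<union> (\<Union>i\<in>K. X i)) (k i + (\<Sum>i\<in>K. k i))"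
  proof (intro cycle_coverable_Un insert.IH)
    show "X i \<inter> (\<Union>i\<in>K. X i) = {}"
      using insert.hyps(2) insert.prems(2) by (metis (no_types, lifting) Int_UN_distrib UN_E all_not_in_conv insertCI)
  qed (use insert in auto)
  then show ?case using insert by simp
qed

text \<open>The last vertex of \<open>N\<close> along the path is joined to the head
  \<open>x\<close>; cutting the path behind it leaves a cycle through all of \<open>N\<close>. For
  empty \<open>N\<close> the cycle is \<open>x\<close> alone.\<close>

lemma close_path:
  assumes "successively E (x # zs)" "distinct (x # zs)" "N \<subseteq> set zs"
    "\<And>w. w \<in> N \<Longrightarrow> E w x"
  obtains ys zs' where "zs = ys @ zs'" "N \<subseteq> set ys" "is_cycle E (x # ys)"
proof (cases "N = {}")
  case True
  then show ?thesis using assms by (intro that[of "[]" zs]) (auto simp: is_cycle_def)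
next
  case False
  then have "\<exists>w\<in>set zs. w \<in> N" using assms(3) by blast
  from split_list_last_prop[OF this]
  obtain ys w zs' where s: "zs = ys @ w # zs'" "w \<in> N" "\<forall>z\<in>set zs'. z \<notin> N"
    by (elim exE conjE)
  have "successively E ((x # ys @ [w]) @ zs')" using assms(1) s(1) by simp
  then have "successively E (x # ys @ [w])" by (simp only: successively_append_iff)
  then show ?thesis using s assms
    by (intro that[of "ys @ [w]" zs']) (auto simp: is_cycle_def)
qed

text \<open>Take a longest path: a vertex joined to its head but missing from it could be
  prepended.\<close>

lemma path_head_maximal:
  assumes "finite V" "v \<in> V"
  obtains x zs where "successively E (x # zs)" "distinct (x # zs)" "set (x # zs) \<subseteq> V"
    "\<And>w. w \<in> V \<Longrightarrow> E w x \<Longrightarrow> w \<noteq> x \<Longrightarrow> w \<in> set zs"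
proof -
  let ?P = "\<lambda>xs. xs \<noteq> [] \<and> successively E xs \<and> distinct xs \<and> set xs \<subseteq> V"
  have P: "?P [v]" using assms by simp
  obtain ys where ys: "?P ys" "\<And>zs. ?P zs \<Longrightarrow> length zs \<le> length ys"
    by (rule exists_longest_list[of V ?P, OF assms(1) P]) (simp, rule that)
  then obtain x zs where e: "ys = x # zs" by (cases ys) auto
  have "w \<in> set zs" if w: "w \<in> V" "E w x" "w \<noteq> x" for w
  proof (rule ccontr)
    assume "w \<notin> set zs"
    then have "?P (w # ys)" using ys(1) e w by auto
    then show False using ys(2) by fastforce
  qed
  then show thesis using ys e that by auto
qed

text \<open>A maximal path closes to a cycle through \<open>x\<close> and all its neighbours. Hence
  \<open>x\<close> extends every independent set outside that cycle, so removing the cycle lowers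
  the independence number.\<close>

lemma cycle_cover_by_independence_number:
  assumes "finite V" "\<And>u v. E u v \<Longrightarrow> E v u"
    "\<And>I. I \<subseteq> V \<Longrightarrow> pairwise (\<lambda>u v. \<not> E u v) I \<Longrightarrow> card I \<le> k"
  shows "cycle_coverable (is_cycle E) V k"
  using assms(1,3)
proof (induction k arbitrary: V)
  case 0
  have "V = {}"
  proof (rule ccontr)
    assume "V \<noteq> {}"
    then obtain v where "v \<in> V" by blast
    then show False using 0(2)[of "{v}"] by (simp add: pairwise_def)
  qed
  then show ?case by (simp add: cycle_coverable_empty)
next
  case (Suc k)
  show ?case
  proof (cases "V = {}")
    case True
    then show ?thesis by (simp add: cycle_coverable_empty)
  next
    case False
    then obtain v where "v \<in> V" by blast
    then obtain x zs where xz: "successively E (x # zs)" "distinct (x # zs)" "set (x # zs) \<subseteq> V"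
      "\<And>w. w \<in> V \<Longrightarrow> E w x \<Longrightarrow> w \<noteq> x \<Longrightarrow> w \<in> set zs"
      using path_head_maximal[OF Suc.prems(1), of v E] by blast
    define N where "N = {w \<in> V. E w x \<and> w \<noteq> x}"
    have "N \<subseteq> set zs" "\<And>w. w \<in> N \<Longrightarrow> E w x" using xz(4) by (auto simp: N_def)
    from close_path[OF xz(1,2) this]
    obtain ys zs' where ys: "zs = ys @ zs'" "N \<subseteq> set ys" "is_cycle E (x # ys)"
      by blast
    let ?C = "set (x # ys)"
    have "?C \<subseteq> V" using xz ys by auto
    have "card I \<le> k" if I: "I \<subseteq> V - ?C" "pairwise (\<lambda>u v. \<not> E u v) I" for I
    proof -
      have "\<not> E w x" if "w \<in> I" for w using that I(1) ys(2) by (auto simp: N_def)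
      then have "pairwise (\<lambda>u v. \<not> E u v) (insert x I)"
        using I(2) assms(2) by (auto simp: pairwise_insert)
      moreover have "insert x I \<subseteq> V" "x \<notin> I" "finite I"
        using I(1) xz(3) finite_subset[OF I(1)] Suc.prems(1) by auto
      ultimately show ?thesis using Suc.prems(2)[of "insert x I"] by simp
    qed
    then have "cycle_coverable (is_cycle E) (V - ?C) k"
      using Suc.IH[of "V - ?C"] Suc.prems(1) by blast
    moreover have "cycle_coverable (is_cycle E) ?C 1"
      using ys(3) by (intro cycle_coverable_single) (auto simp: is_cycle_def)
    ultimately have "cycle_coverable (is_cycle E) (?C \<union> (V - ?C)) (1 + k)"
      by (intro cycle_coverable_Un) auto
    moreover have "?C \<union> (V - ?C) = V" using \<open>?C \<subseteq> V\<close> by blast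
    ultimately show ?thesis by (simp only: plus_1_eq_Suc)
  qed
qed

text \<open>The head of a maximal path has more than \<open>k\<close> neighbours, all on the path;
  the closed cycle contains them and the head itself.\<close>

lemma long_cycle_of_min_degree:
  assumes "finite T" "T \<noteq> {}" "\<And>t. t \<in> T \<Longrightarrow> card t = 2"
    "\<And>t v. t \<in> T \<Longrightarrow> v \<in> t \<Longrightarrow> k < card {u \<in> T. v \<in> u}"
  obtains xs where "is_cycle (\<lambda>u v. {u, v} \<in> T) xs" "set xs \<subseteq> \<Union>T" "k + 2 \<le> length xs"
proof -
  let ?E = "\<lambda>u v. {u, v} \<in> T"
  have fin: "finite (\<Union>T)" using assms(1,3) by (metis card.infinite finite_Union zero_neq_numeral)
  obtain t where "t \<in> T" using assms(2) by blast
  then obtain v where v: "v \<in> \<Union>T" using assms(3)[of t] by (fastforce simp: card_2_iff)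
  obtain x zs where xz: "successively ?E (x # zs)" "distinct (x # zs)" "set (x # zs) \<subseteq> \<Union>T"
      "\<And>w. w \<in> \<Union>T \<Longrightarrow> ?E w x \<Longrightarrow> w \<noteq> x \<Longrightarrow> w \<in> set zs"
    using path_head_maximal[OF fin v, of ?E] by blast
  define N where "N = {w. {w, x} \<in> T \<and> w \<noteq> x}"
  have N: "N \<subseteq> set zs" "\<And>w. w \<in> N \<Longrightarrow> ?E w x" using xz(4) unfolding N_def by blast+
  from close_path[OF xz(1,2) this]
  obtain ys zs' where ys: "zs = ys @ zs'" "N \<subseteq> set ys" "is_cycle ?E (x # ys)"
    by blast
  have "{u \<in> T. x \<in> u} \<subseteq> (\<lambda>w. {w, x}) ` N"
  proof
    fix u assume "u \<in> {u \<in> T. x \<in> u}"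
    then have u: "u \<in> T" "x \<in> u" by auto
    then obtain w where "u = {w, x}" "w \<noteq> x" using assms(3)[of u] by (auto simp: card_2_iff)
    then show "u \<in> (\<lambda>w. {w, x}) ` N" using u by (auto simp: N_def)
  qed
  moreover have "finite N" using N(1) finite_subset by auto
  ultimately have "card {u \<in> T. x \<in> u} \<le> card N" by (meson surj_card_le)
  moreover have "k < card {u \<in> T. x \<in> u}" using xz(3) assms(4) by auto
  moreover have "card N \<le> length ys" using ys(2) by (meson card_length card_mono finite_set order_trans)
  ultimately have "k + 2 \<le> length (x # ys)" by simp
  then show thesis using that[of "x # ys"] ys xz by auto
qed

section \<open>Absorbing cycles from tight paths\<close>

text \<open>If \<open>T\<close> consists of triangles, vertices at distance one or two on such a
  path are adjacent. Lists of fewer than three vertices qualify vacuously.\<close>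

fun tight_path :: "'a set set \<Rightarrow> 'a list \<Rightarrow> bool" where
  "tight_path T (x # y # z # zs) \<longleftrightarrow> {x, y, z} \<in> T \<and> tight_path T (y # z # zs)"
| "tight_path T _ \<longleftrightarrow> True"

lemma tight_path_append1: "tight_path T (xs @ ys) \<Longrightarrow> tight_path T xs"
  by (induction T xs rule: tight_path.induct) auto

text \<open>The vertices at odd positions, except a final one. In a tight path they can be left out
  in any combination, since both neighbours of a left-out vertex stay and are adjacent.\<close>

fun inner_odd :: "'a list \<Rightarrow> 'a set" where
  "inner_odd (x # b # y # zs) = insert b (inner_odd (y # zs))"
| "inner_odd _ = {}"

lemma inner_odd_subset: "inner_odd (x # xs) \<subseteq> set xs"
proof (induction "x # xs" arbitrary: x xs rule: inner_odd.induct)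
  case (1 x b y zs)
  then show ?case by auto
qed auto

text \<open>Each two positions contribute one vertex, and the recursion stops with at most two
  positions left.\<close>

lemma card_inner_odd: "distinct xs \<Longrightarrow> length xs \<le> 2 * card (inner_odd xs) + 2"
proof (induction xs rule: inner_odd.induct)
  case (1 x b y zs)
  have "b \<notin> inner_odd (y # zs)" using 1(2) inner_odd_subset[of y zs] by auto
  moreover have "finite (inner_odd (y # zs))"
    using inner_odd_subset[of y zs] finite_subset by blast
  ultimately show ?case using 1 by simp
qed auto

text \<open>The length bound excludes the short lists, on which tightness gives no edge.\<close>

lemma tight_path_successively:
  assumes "\<And>t u v. t \<in> T \<Longrightarrow> u \<in> t \<Longrightarrow> v \<in> t \<Longrightarrow> u \<noteq> v \<Longrightarrow> E u v"
  shows "tight_path T xs \<Longrightarrow> distinct xs \<Longrightarrow> 3 \<le> length xs \<Longrightarrow> successively E xs"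
  using assms
proof (induction T xs rule: tight_path.induct)
  case (1 T x y z zs)
  then have t: "{x, y, z} \<in> T" by simp
  have "E x y" "E y z" by (rule 1(5)[OF t]; use 1(3) in auto)+
  moreover have "successively E (y # z # zs)" if "zs \<noteq> []"
  proof (rule 1(1))
    show "3 \<le> length (y # z # zs)" using that by (cases zs) auto
  qed (use 1 in auto)
  ultimately show ?case by (cases zs) auto
qed auto

text \<open>When \<open>b\<close> is dropped from \<open>x\<close>, \<open>b\<close>,
  \<open>y\<close>, the triple supplies the edge from \<open>x\<close> to \<open>y\<close>. The
  hypothesis \<open>successively\<close> serves the short final segments, which tightness does not
  control. Keeping the last vertex preserves the closing edge of a cycle.\<close>

lemma tight_path_drop:
  assumes "\<And>t u v. t \<in> T \<Longrightarrow> u \<in> t \<Longrightarrow> v \<in> t \<Longrightarrow> u \<noteq> v \<Longrightarrow> E u v"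
  shows "distinct (x # xs) \<Longrightarrow> tight_path T (x # xs) \<Longrightarrow> successively E (x # xs) \<Longrightarrow>
    B \<subseteq> inner_odd (x # xs) \<Longrightarrow>
    successively E (x # filter (\<lambda>v. v \<notin> B) xs) \<and>
    last (x # filter (\<lambda>v. v \<notin> B) xs) = last (x # xs)"
proof (induction "x # xs" arbitrary: x xs B rule: inner_odd.induct)
  case (1 x b y zs)
  let ?f = "filter (\<lambda>v. v \<notin> B) zs" and ?B = "B - {b}"
  have y: "y \<notin> B" using 1 inner_odd_subset[of y zs] by auto
  \<comment> \<open>The induction hypothesis only admits subsets of
    \<open>inner_odd (y # zs)\<close>, so \<open>b\<close> is taken out of \<open>B\<close>; since
    \<open>b\<close> does not occur in \<open>zs\<close>, the filtered tail is unchanged.\<close>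
  have "filter (\<lambda>v. v \<notin> ?B) zs = ?f" using 1(2) by (intro filter_cong) auto
  moreover have "tight_path T (y # zs)" using 1(3) by (cases zs) auto
  moreover have "?B \<subseteq> inner_odd (y # zs)" using 1(5) by auto
  ultimately have "successively E (y # ?f) \<and> last (y # ?f) = last (y # zs)"
    using 1(1)[of ?B] 1(2-4) by auto
  moreover have "{x, b, y} \<in> T" using 1(3) by simp
  then have "E x b" "E b y" "E x y" using 1(2) assms by auto
  ultimately show ?case using y by auto
qed auto

text \<open>A longest tight path has a head pair \<open>x\<close>, \<open>y\<close> lying in more
  than \<open>k\<close> triples, which forces a long cycle. \<open>B\<close> is the set of its inner
  odd vertices and \<open>Z\<close> the rest of the cycle.\<close>

lemma tight_path_absorber:
  assumes E: "\<And>t u v. t \<in> T \<Longrightarrow> u \<in> t \<Longrightarrow> v \<in> t \<Longrightarrow> u \<noteq> v \<Longrightarrow> E u v"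
    and T: "finite T" "T \<noteq> {}" "\<And>t. t \<in> T \<Longrightarrow> card t = 3"
    and deg: "\<And>t u v. t \<in> T \<Longrightarrow> u \<in> t \<Longrightarrow> v \<in> t \<Longrightarrow> u \<noteq> v \<Longrightarrow> k < card {t' \<in> T. {u, v} \<subseteq> t'}"
  obtains Z B where "Z \<inter> B = {}" "Z \<union> B \<subseteq> \<Union>T" "k \<le> 2 * card B"
    "\<And>B'. B' \<subseteq> B \<Longrightarrow> \<exists>xs. is_cycle E xs \<and> set xs = Z \<union> (B - B')"
proof -
  let ?P = "\<lambda>xs. tight_path T xs \<and> distinct xs \<and> set xs \<subseteq> \<Union>T"
  have fin: "finite (\<Union>T)" using T(1,3) by (metis card.infinite finite_Union zero_neq_numeral)
  obtain t where t: "t \<in> T" using T(2) by blast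
  then obtain x0 y0 z0 where t0: "t = {x0, y0, z0}" "x0 \<noteq> y0" "y0 \<noteq> z0" "x0 \<noteq> z0"
    using T(3)[of t] by (auto simp: card_3_iff)
  have P0: "?P [x0, y0, z0]" using t t0 by auto
  obtain ys where ys: "?P ys" "\<And>zs. ?P zs \<Longrightarrow> length zs \<le> length ys"
    by (rule exists_longest_list[of "\<Union>T" ?P, OF fin P0]) (simp, rule that)
  have "3 \<le> length ys" using ys(2)[OF P0] by simp
  then obtain x y z zs where e: "ys = x # y # z # zs"
    by (auto simp: numeral_3_eq_3 Suc_le_length_iff)
  have xyz: "{x, y, z} \<in> T" "x \<noteq> y" using ys(1) e by auto
  \<comment> \<open>By maximality every tight extension at the head lies on the path, so the farthest one closes a cycle
    through all of them.\<close>
  define N where "N = {w. {x, y, w} \<in> T \<and> w \<noteq> x \<and> w \<noteq> y}"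
  have N: "N \<subseteq> set (z # zs)"
  proof
    fix w assume w: "w \<in> N"
    show "w \<in> set (z # zs)"
    proof (rule ccontr)
      assume "w \<notin> set (z # zs)"
      then have "?P (w # ys)" using w ys(1) e by (auto simp: N_def insert_commute)
      then show False using ys(2) by fastforce
    qed
  qed
  then have finN: "finite N" using finite_subset by blast
  have "{t' \<in> T. {x, y} \<subseteq> t'} \<subseteq> (\<lambda>w. {x, y, w}) ` N"
  proof
    fix u assume u: "u \<in> {t' \<in> T. {x, y} \<subseteq> t'}"
    then obtain w where "u = {x, y, w}" "w \<noteq> x" "w \<noteq> y"
      using T(3)[of u] xyz(2) by (auto simp: card_3_iff)
    then show "u \<in> (\<lambda>w. {x, y, w}) ` N" using u by (auto simp: N_def)
  qed
  then have "card {t' \<in> T. {x, y} \<subseteq> t'} \<le> card N" using finN by (meson surj_card_le)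
  then have kN: "k < card N" using deg[OF xyz(1), of x y] xyz(2) by simp
  then have "N \<noteq> {}" by auto
  then have "\<exists>w\<in>set (z # zs). w \<in> N" using N by blast
  from split_list_last_prop[OF this]
  obtain qs w qs' where q: "z # zs = qs @ w # qs'" "w \<in> N" "\<forall>z\<in>set qs'. z \<notin> N"
    by (elim exE conjE)
  define p where "p = y # qs @ [w]"
  have ysp: "ys = (x # p) @ qs'" using e q(1) by (simp add: p_def)
  have p: "tight_path T (x # p)" "distinct (x # p)" "set (x # p) \<subseteq> \<Union>T"
    using ys(1) tight_path_append1[of T "x # p" qs'] unfolding ysp by auto
  have "N \<subseteq> set (qs @ [w])" using N q by auto
  then have "card N \<le> length (qs @ [w])" by (meson card_length card_mono finite_set order_trans)
  \<comment> \<open>To the more than \<open>k\<close> vertices of \<open>N\<close> come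
    \<open>x\<close> and \<open>y\<close>.\<close>
  then have len: "k + 3 \<le> length (x # p)" using kN by (simp add: p_def)
  have succ: "successively E (x # p)"
    using tight_path_successively[OF E p(1,2)] len by simp
  have "E w x" using E[of "{x, y, w}" w x] q(2) by (auto simp: N_def)
  let ?B = "inner_odd (x # p)"
  have B: "?B \<subseteq> set p" by (rule inner_odd_subset)
  show thesis
  proof (rule that[of "set (x # p) - ?B" ?B])
    show "(set (x # p) - ?B) \<inter> ?B = {}" by blast
    show "set (x # p) - ?B \<union> ?B \<subseteq> \<Union>T" using p(3) B by auto
    show "k \<le> 2 * card ?B" using card_inner_odd[OF p(2)] len by simp
    fix B' assume B': "B' \<subseteq> ?B"
    let ?c = "x # filter (\<lambda>v. v \<notin> B') p"
    have d: "successively E ?c" "last ?c = last (x # p)"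
      using tight_path_drop[OF E p(2,1) succ B'] by auto
    \<comment> \<open>Dropping \<open>B'\<close> keeps both ends \<open>x\<close> and
      \<open>w\<close>, hence also the closing edge between them.\<close>
    have "is_cycle E ?c"
      using d p(2) \<open>E w x\<close> by (auto simp: is_cycle_def p_def)
    moreover have "set ?c = (set (x # p) - ?B) \<union> (?B - B')"
      using B B' p(2) by auto
    ultimately show "\<exists>xs. is_cycle E xs \<and> set xs = (set (x # p) - ?B) \<union> (?B - B')" by blast
  qed
qed

section \<open>Covering one side of a bipartite graph\<close>

lemma exists_fresh:
  assumes "M \<le> card S" "finite X" "card X < M"
  obtains b where "b \<in> S" "b \<notin> X"
proof -
  have "\<not> S \<subseteq> X" using assms card_mono[of X S] by auto
  then show thesis using that by blast
qed

definition mono_cyc :: "('a set \<Rightarrow> 'b) \<Rightarrow> 'a list \<Rightarrow> bool" where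
  "mono_cyc c xs \<longleftrightarrow> (\<exists>col. is_cycle (\<lambda>u v. c {u, v} = col) xs)"

text \<open>Stated for an arbitrary vertex set, so that the condition can be passed to subsets in
  the Ramsey induction and in the greedy removal.\<close>

definition locally_coloured :: "nat \<Rightarrow> 'a set \<Rightarrow> ('a set \<Rightarrow> 'b) \<Rightarrow> bool" where
  "locally_coloured r V c \<longleftrightarrow> (\<forall>v\<in>V. card ((\<lambda>w. c {v, w}) ` (V - {v})) \<le> r)"

lemma locally_coloured_subset:
  assumes "locally_coloured r V c" "W \<subseteq> V" "finite V"
  shows "locally_coloured r W c"
  unfolding locally_coloured_def
proof
  fix v assume v: "v \<in> W"
  have "card ((\<lambda>w. c {v, w}) ` (W - {v})) \<le> card ((\<lambda>w. c {v, w}) ` (V - {v}))"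
    using assms(2,3) by (intro card_mono) auto
  also have "\<dots> \<le> r" using assms v by (auto simp: locally_coloured_def)
  finally show "card ((\<lambda>w. c {v, w}) ` (W - {v})) \<le> r" .
qed

definition link_nbrs :: "('a set \<Rightarrow> 'b) \<Rightarrow> 'a set \<Rightarrow> 'b \<Rightarrow> 'a \<Rightarrow> 'a set" where
  "link_nbrs c B col a = {b \<in> B. c {a, b} = col}"

text \<open>A cycle in this auxiliary graph becomes a cycle of colour \<open>col\<close> by subdividing each of its
  edges with a fresh common neighbour in \<open>B\<close>.\<close>

definition linked :: "('a set \<Rightarrow> 'b) \<Rightarrow> 'a set \<Rightarrow> nat \<Rightarrow> 'b \<Rightarrow> 'a \<Rightarrow> 'a \<Rightarrow> bool" where
  "linked c B M col a a' \<longleftrightarrow> M \<le> card (link_nbrs c B col a \<inter> link_nbrs c B col a')"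

section \<open>Subdividing auxiliary cycles\<close>

text \<open>Working from the tail, fewer than \<open>length as\<close> vertices of \<open>B\<close>
  are in use, so \<open>card F + length as \<le> M\<close> always leaves a common neighbour outside
  \<open>F\<close> that is still free.\<close>

lemma subdivide_path:
  assumes "finite B" "finite F"
  shows "as \<noteq> [] \<Longrightarrow> successively (linked c B M col) as \<Longrightarrow> distinct as \<Longrightarrow>
    set as \<inter> B = {} \<Longrightarrow> card F + length as \<le> M \<Longrightarrow>
    \<exists>xs. xs \<noteq> [] \<and> successively (\<lambda>u v. c {u, v} = col) xs \<and> distinct xs \<and>
      hd xs = hd as \<and> last xs = last as \<and> set as \<subseteq> set xs \<and>
      set xs \<subseteq> set as \<union> (B - F) \<and> card (set xs \<inter> B) < length as"
proof (induction as)
  case Nil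
  then show ?case by simp
next
  case (Cons a as)
  show ?case
  proof (cases "as = []")
    case True
    then show ?thesis using Cons.prems by (intro exI[of _ "[a]"]) auto
  next
    case False
    have "successively (linked c B M col) as" using Cons.prems(2) by (cases as) auto
    then obtain xs where xs: "xs \<noteq> []" "successively (\<lambda>u v. c {u, v} = col) xs" "distinct xs"
      "hd xs = hd as" "last xs = last as" "set as \<subseteq> set xs"
      "set xs \<subseteq> set as \<union> (B - F)" "card (set xs \<inter> B) < length as"
      using Cons.IH[OF False] Cons.prems by auto
    have "card (F \<union> (set xs \<inter> B)) \<le> card F + card (set xs \<inter> B)" by (rule card_Un_le)
    also have "\<dots> < M" using xs(8) Cons.prems(5) by simp
    finally have less: "card (F \<union> (set xs \<inter> B)) < M" .
    have "M \<le> card (link_nbrs c B col a \<inter> link_nbrs c B col (hd as))"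
      using Cons.prems(2) False by (cases as) (auto simp: linked_def)
    then obtain b where b: "b \<in> link_nbrs c B col a" "b \<in> link_nbrs c B col (hd as)"
      "b \<notin> F \<union> (set xs \<inter> B)"
      using exists_fresh[OF _ _ less] assms(2) by auto
    have bB: "b \<in> B" "b \<notin> F" "b \<notin> set xs" "c {a, b} = col" "c {b, hd xs} = col"
      using b xs(4) by (auto simp: link_nbrs_def insert_commute)
    have "set (a # b # xs) \<inter> B = insert b (set xs \<inter> B)" using bB Cons.prems(4) by auto
    then have "card (set (a # b # xs) \<inter> B) < length (a # as)"
      using xs(8) by (simp add: card_insert_if)
    moreover have "a \<notin> set xs" "a \<noteq> b" using Cons.prems(3,4) xs(7) bB by auto
    moreover have "successively (\<lambda>u v. c {u, v} = col) (a # b # xs)"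
      using xs(1,2) bB by (cases xs) auto
    ultimately show ?thesis using xs bB False by (intro exI[of _ "a # b # xs"]) auto
  qed
qed

text \<open>The subdivided path uses fewer than \<open>length as\<close> vertices of
  \<open>B\<close>, so one more free vertex remains for the closing edge. An auxiliary cycle on two
  vertices thus becomes a four-cycle.\<close>

lemma subdivide_cycle:
  assumes "finite B" "finite F" "is_cycle (linked c B M col) as" "set as \<inter> B = {}"
    "card F + length as \<le> M"
  shows "\<exists>xs. is_cycle (\<lambda>u v. c {u, v} = col) xs \<and> set as \<subseteq> set xs \<and>
      set xs \<subseteq> set as \<union> (B - F) \<and> card (set xs \<inter> B) \<le> length as"
proof (cases "length as \<ge> 2")
  case False
  then obtain a where "as = [a]" using assms(3) by (cases as rule: list.exhaust) (auto simp: is_cycle_def Suc_le_eq numeral_2_eq_2)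
  then show ?thesis using assms(4) by (intro exI[of _ "[a]"]) (auto simp: is_cycle_def)
next
  case True
  have as: "as \<noteq> []" "successively (linked c B M col) as" "distinct as"
    "linked c B M col (last as) (hd as)"
    using assms(3) True by (auto simp: is_cycle_def)
  obtain xs where xs: "xs \<noteq> []" "successively (\<lambda>u v. c {u, v} = col) xs" "distinct xs"
      "hd xs = hd as" "last xs = last as" "set as \<subseteq> set xs"
      "set xs \<subseteq> set as \<union> (B - F)" "card (set xs \<inter> B) < length as"
    using subdivide_path[OF assms(1,2) as(1-3) assms(4,5)] by blast
  have "card (F \<union> (set xs \<inter> B)) \<le> card F + card (set xs \<inter> B)" by (rule card_Un_le)
  also have "\<dots> < M" using xs(8) assms(5) by simp
  finally have less: "card (F \<union> (set xs \<inter> B)) < M" .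
  then obtain b where b: "b \<in> link_nbrs c B col (last as)" "b \<in> link_nbrs c B col (hd as)"
      "b \<notin> F \<union> (set xs \<inter> B)"
    using exists_fresh[OF as(4)[unfolded linked_def] _ less] assms(2) by auto
  have bB: "b \<in> B" "b \<notin> F" "b \<notin> set xs" "c {last xs, b} = col" "c {b, hd xs} = col"
    using b xs(4,5) by (auto simp: link_nbrs_def insert_commute)
  have "set (xs @ [b]) \<inter> B = insert b (set xs \<inter> B)" using bB by auto
  then have "card (set (xs @ [b]) \<inter> B) \<le> length as"
    using xs(8) by (simp add: card_insert_if)
  moreover have "is_cycle (\<lambda>u v. c {u, v} = col) (xs @ [b])"
    using xs(1-3) bB by (auto simp: is_cycle_def successively_append_iff)
  ultimately show ?thesis using xs bB by (intro exI[of _ "xs @ [b]"]) auto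
qed

text \<open>The vertices of \<open>B\<close> used by one cycle are added to the forbidden set
  \<open>F\<close> for the next; the total consumption stays below the total length of the auxiliary
  cycles.\<close>

lemma subdivide_cycles:
  assumes "finite B"
  shows "\<forall>as\<in>set P. \<exists>col. is_cycle (linked c B M col) as \<Longrightarrow> distinct (concat P) \<Longrightarrow>
    set (concat P) \<inter> B = {} \<Longrightarrow> finite F \<Longrightarrow> card F + length (concat P) \<le> M \<Longrightarrow>
    \<exists>Q. length Q = length P \<and> (\<forall>xs\<in>set Q. mono_cyc c xs) \<and> distinct (concat Q) \<and>
      set (concat P) \<subseteq> set (concat Q) \<and> set (concat Q) \<subseteq> set (concat P) \<union> (B - F)"
proof (induction P arbitrary: F)
  case Nil
  then show ?case by (intro exI[of _ "[]"]) auto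
next
  case (Cons as P)
  obtain col where col: "is_cycle (linked c B M col) as" using Cons.prems(1) by auto
  have "set as \<inter> B = {}" "card F + length as \<le> M" using Cons.prems(3,5) by auto
  from subdivide_cycle[OF assms Cons.prems(4) col this]
  obtain xs where xs: "is_cycle (\<lambda>u v. c {u, v} = col) xs" "set as \<subseteq> set xs"
      "set xs \<subseteq> set as \<union> (B - F)" "card (set xs \<inter> B) \<le> length as"
    by (elim exE conjE)
  have d: "distinct as" "distinct (concat P)" "set as \<inter> set (concat P) = {}"
    using Cons.prems(2) by auto
  have dB: "set as \<inter> B = {}" "set (concat P) \<inter> B = {}" using Cons.prems(3) by auto
  let ?F = "F \<union> (set xs \<inter> B)"
  have "card ?F \<le> card F + card (set xs \<inter> B)" by (rule card_Un_le)
  then have F: "card ?F + length (concat P) \<le> M" using xs(4) Cons.prems(5) by simp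
  have "\<forall>as\<in>set P. \<exists>col. is_cycle (linked c B M col) as" "finite ?F"
    using Cons.prems(1,4) by auto
  from Cons.IH[OF this(1) d(2) dB(2) this(2) F]
  obtain Q where Q: "length Q = length P" "\<forall>xs\<in>set Q. mono_cyc c xs" "distinct (concat Q)"
      "set (concat P) \<subseteq> set (concat Q)" "set (concat Q) \<subseteq> set (concat P) \<union> (B - ?F)"
    by (elim exE conjE)
  have "set xs \<inter> set (concat Q) = {}" using d(3) dB xs(3) Q(5) by blast
  moreover have "distinct xs" "mono_cyc c xs" using xs(1) by (auto simp: is_cycle_def mono_cyc_def)
  ultimately have "distinct (concat (xs # Q))" "\<forall>ys\<in>set (xs # Q). mono_cyc c ys"
    using Q by auto
  moreover have "set (concat (as # P)) \<subseteq> set (concat (xs # Q))"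
    using xs(2) Q(4) by auto
  moreover have "set (concat (xs # Q)) \<subseteq> set (concat (as # P)) \<union> (B - F)"
    using xs(3) Q(5) by auto
  ultimately show ?case using Q(1) by (intro exI[of _ "xs # Q"]) simp
qed

text \<open>Pigeonhole, multiplied out to avoid division: some fibre has at least the average
  size.\<close>

lemma popular_value:
  assumes "finite S" "S \<noteq> {}" "card (f ` S) \<le> r"
  shows "\<exists>y\<in>f ` S. card S \<le> r * card {x \<in> S. f x = y}"
proof (rule ccontr)
  assume "\<not> ?thesis"
  then have l: "r * card {x \<in> S. f x = y} < card S" if "y \<in> f ` S" for y using that by force
  have "r * card S = (\<Sum>y\<in>f ` S. r * card {x \<in> S. f x = y})"
    using sum.image_gen[OF assms(1), of "\<lambda>_. 1::nat" f] by (simp add: sum_distrib_left)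
  also have "\<dots> < (\<Sum>y\<in>f ` S. card S)"
    using l assms by (intro sum_strict_mono) auto
  also have "\<dots> \<le> r * card S" using assms(3) by simp
  finally show False by simp
qed

text \<open>Each vertex of \<open>A\<close> is assigned a colour frequent on its edges to
  \<open>B\<close>. Each resulting class is covered by cycles of its \<open>linked\<close> graph,
  and all of these are then subdivided through \<open>B\<close>.\<close>

lemma cover_by_bipartite_cycles:
  assumes V: "finite V" "locally_coloured r V c" "A \<union> B \<subseteq> V" "A \<inter> B = {}"
    and r: "0 < r" and AB: "4 * r^2 * card A \<le> card B"
  shows "\<exists>B'\<subseteq>B. cycle_coverable (mono_cyc c) (A \<union> B') (2 * r^2)"
proof (cases "A = {}")
  case True
  then show ?thesis by (intro exI[of _ "{}"]) (auto simp: cycle_coverable_empty)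
next
  case False
  have fin: "finite A" "finite B" using V finite_subset by auto
  then have "0 < card A" using False by (simp add: card_gt_0_iff)
  then have "0 < card B" using AB r by (metis gr0I mult_is_0 not_le power_not_zero zero_neq_numeral)
  then have "B \<noteq> {}" by auto
  let ?M = "card A" and ?N = "link_nbrs c B"
  have "\<exists>col. card B \<le> r * card (?N col a)" if "a \<in> A" for a
  proof -
    have "card ((\<lambda>b. c {a, b}) ` B) \<le> card ((\<lambda>b. c {a, b}) ` (V - {a}))"
      using V that by (intro card_mono) auto
    also have "\<dots> \<le> r" using V that by (auto simp: locally_coloured_def)
    finally show ?thesis
      using popular_value[OF fin(2) \<open>B \<noteq> {}\<close>, of "\<lambda>b. c {a, b}" r]
      by (auto simp: link_nbrs_def)
  qed
  then obtain f where f: "\<And>a. a \<in> A \<Longrightarrow> card B \<le> r * card (?N (f a) a)" by metis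
  \<comment> \<open>The vertices assigned a colour may only be joined through \<open>Bc col\<close>, so the independence number
    of the auxiliary graph is at most \<open>k col\<close>. Each vertex of \<open>B\<close> lies in at most \<open>r\<close> of the sets \<open>Bc col\<close>,
    which bounds the sum of the \<open>k col\<close> although the number of colours is not bounded.\<close>
  define Bc where "Bc col = {b \<in> B. \<exists>a\<in>A. c {a, b} = col}" for col
  define k where "k col = 2 * r * card (Bc col) div card B" for col
  let ?Ac = "\<lambda>col. {a \<in> A. f a = col}"
  have Nfin: "finite (?N col a)" for col a using fin by (simp add: link_nbrs_def)
  have cov: "cycle_coverable (is_cycle (linked c B ?M col)) (?Ac col) (k col)" for col
  proof (rule cycle_cover_by_independence_number)
    show "finite (?Ac col)" using fin by simp
    show "linked c B ?M col u v \<Longrightarrow> linked c B ?M col v u" for u v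
      by (simp add: linked_def Int_commute)
    fix I assume I: "I \<subseteq> ?Ac col" "pairwise (\<lambda>u v. \<not> linked c B ?M col u v) I"
    show "card I \<le> k col"
    proof (rule ccontr)
      assume "\<not> ?thesis"
      then obtain J where J: "J \<subseteq> I" "card J = Suc (k col)" "finite J"
        by (metis not_less_eq_eq obtain_subset_with_card_n)
      \<comment> \<open>A bound on \<open>k col\<close> is needed since each vertex of
        \<open>J\<close> may lose up to \<open>k col * card A\<close> neighbours to the
        others.\<close>
      have "card (Bc col) \<le> card B" using fin by (intro card_mono) (auto simp: Bc_def)
      then have "k col \<le> 2 * r * card B div card B" unfolding k_def
        by (intro div_le_mono mult_left_mono) auto
      then have k2: "k col \<le> 2 * r" using \<open>0 < card B\<close> by simp
      \<comment> \<open>The sets \<open>N' a\<close> are disjoint and keep at least half of the guaranteed size of \<open>?N col a\<close>.\<close>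
      define N' where "N' a = ?N col a - (\<Union>a'\<in>J - {a}. ?N col a')" for a
      have big: "card B \<le> 2 * r * card (N' a)" if a: "a \<in> J" for a
      proof -
        have "?N col a \<subseteq> N' a \<union> (\<Union>a'\<in>J - {a}. ?N col a \<inter> ?N col a')"
          by (auto simp: N'_def)
        then have "card (?N col a) \<le> card (N' a \<union> (\<Union>a'\<in>J - {a}. ?N col a \<inter> ?N col a'))"
          using J(3) Nfin by (intro card_mono) (auto simp: N'_def)
        also have "\<dots> \<le> card (N' a) + card (\<Union>a'\<in>J - {a}. ?N col a \<inter> ?N col a')"
          by (rule card_Un_le)
        also have "card (\<Union>a'\<in>J - {a}. ?N col a \<inter> ?N col a')
            \<le> (\<Sum>a'\<in>J - {a}. card (?N col a \<inter> ?N col a'))"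
          using J(3) by (intro card_UN_le) auto
        also have "\<dots> \<le> of_nat (card (J - {a})) * ?M"
        proof (rule sum_bounded_above)
          fix a' assume "a' \<in> J - {a}"
          then have "a \<in> I" "a' \<in> I" "a \<noteq> a'" using J(1) a by auto
          then have "\<not> linked c B ?M col a a'" using pairwiseD(1)[OF I(2)] by blast
          then show "card (?N col a \<inter> ?N col a') \<le> ?M" by (simp add: linked_def)
        qed
        also have "of_nat (card (J - {a})) = k col" using J a by simp
        finally have "r * card (?N col a) \<le> r * (card (N' a) + k col * ?M)" by simp
        also have "\<dots> \<le> r * card (N' a) + 2 * r^2 * ?M"
          using k2 by (simp add: power2_eq_square algebra_simps)
        \<comment> \<open>Here the factor 4 in the size hypothesis is spent: the overlaps cost at
          most half of \<open>card B\<close>.\<close>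
        finally have "2 * (r * card (?N col a)) \<le> 2 * r * card (N' a) + 4 * r^2 * ?M" by simp
        moreover have "card B \<le> r * card (?N col a)" using f[of a] a J(1) I(1) by auto
        ultimately show ?thesis using AB by linarith
      qed
      have "card J * card B = (\<Sum>a\<in>J. card B)" by simp
      also have "\<dots> \<le> (\<Sum>a\<in>J. 2 * r * card (N' a))" by (intro sum_mono big)
      also have "\<dots> = 2 * r * card (\<Union>a\<in>J. N' a)"
      proof -
        have "card (\<Union>a\<in>J. N' a) = (\<Sum>a\<in>J. card (N' a))"
          using J(3) Nfin by (intro card_UN_disjoint) (auto simp: N'_def)
        then show ?thesis by (simp add: sum_distrib_left)
      qed
      also have "card (\<Union>a\<in>J. N' a) \<le> card (Bc col)"
        using fin J(1) I(1) by (intro card_mono) (auto simp: Bc_def N'_def link_nbrs_def)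
      finally have "Suc (k col) * card B \<le> 2 * r * card (Bc col)" using J(2) by simp
      \<comment> \<open>\<open>k col\<close> is the floor of
        \<open>2 * r * card (Bc col) / card B\<close>, so one more independent vertex is
        impossible.\<close>
      then have "Suc (k col) \<le> k col"
        unfolding k_def using \<open>0 < card B\<close> by (simp add: less_eq_div_iff_mult_less_eq)
      then show False by simp
    qed
  qed
  have cov': "cycle_coverable (\<lambda>xs. \<exists>col. is_cycle (linked c B ?M col) xs)
      (\<Union>col\<in>f ` A. ?Ac col) (\<Sum>col\<in>f ` A. k col)"
    using fin by (intro cycle_coverable_UN cycle_coverable_mono[OF cov order_refl]) auto
  have A: "(\<Union>col\<in>f ` A. ?Ac col) = A" by auto
  have "(\<Sum>col\<in>f ` A. k col) \<le> 2 * r^2"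
  proof -
    have "(\<Sum>col\<in>f ` A. card (Bc col)) = (\<Sum>b\<in>B. card {col \<in> f ` A. \<exists>a\<in>A. c {a, b} = col})"
      unfolding Bc_def using fin by (intro sum_multicount_gen) auto
    also have "\<dots> \<le> (\<Sum>b\<in>B. r)"
    proof (intro sum_mono)
      fix b assume b: "b \<in> B"
      have "card {col \<in> f ` A. \<exists>a\<in>A. c {a, b} = col} \<le> card ((\<lambda>a. c {b, a}) ` (V - {b}))"
      proof (intro card_mono subsetI)
        fix col assume "col \<in> {col \<in> f ` A. \<exists>a\<in>A. c {a, b} = col}"
        then obtain a where "a \<in> A" "c {a, b} = col" by blast
        then have "a \<in> V - {b}" "col = c {b, a}" using V b by (auto simp: insert_commute)
        then show "col \<in> (\<lambda>a. c {b, a}) ` (V - {b})" by blast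
      qed (use V in auto)
      also have "\<dots> \<le> r" using V b by (auto simp: locally_coloured_def)
      finally show "card {col \<in> f ` A. \<exists>a\<in>A. c {a, b} = col} \<le> r" .
    qed
    finally have s: "(\<Sum>col\<in>f ` A. card (Bc col)) \<le> r * card B" by (simp add: mult.commute)
    have "(\<Sum>col\<in>f ` A. k col) * card B = (\<Sum>col\<in>f ` A. k col * card B)"
      by (simp add: sum_distrib_right)
    also have "\<dots> \<le> (\<Sum>col\<in>f ` A. 2 * r * card (Bc col))"
      unfolding k_def by (intro sum_mono div_times_less_eq_dividend)
    also have "\<dots> = 2 * r * (\<Sum>col\<in>f ` A. card (Bc col))" by (simp add: sum_distrib_left)
    also have "\<dots> \<le> 2 * r * (r * card B)" using s by (intro mult_left_mono) auto
    also have "\<dots> = 2 * r^2 * card B" by (simp add: power2_eq_square)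
    finally show ?thesis using \<open>0 < card B\<close> by simp
  qed
  then have "cycle_coverable (\<lambda>xs. \<exists>col. is_cycle (linked c B ?M col) xs) A (2 * r^2)"
    by (rule cycle_coverable_mono[OF cov'[unfolded A]])
  then obtain P where P: "\<forall>xs\<in>set P. \<exists>col. is_cycle (linked c B ?M col) xs"
      "distinct (concat P)" "set (concat P) = A" "length P \<le> 2 * r^2"
    unfolding cycle_coverable_def by (elim exE conjE)
  \<comment> \<open>The auxiliary cycles partition \<open>A\<close>, so the linking threshold
    \<open>card A\<close> suffices for subdividing all of them at once.\<close>
  have "length (concat P) = card A" using P(2,3) distinct_card by metis
  then have "card {} + length (concat P) \<le> ?M" by simp
  from subdivide_cycles[OF fin(2) P(1,2) _ finite.emptyI this] P(3) V(4)
  have "\<exists>Q. length Q = length P \<and> (\<forall>xs\<in>set Q. mono_cyc c xs) \<and> distinct (concat Q) \<and>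
      A \<subseteq> set (concat Q) \<and> set (concat Q) \<subseteq> A \<union> B"
    by (simp only: Diff_empty)
  then obtain Q where Q: "length Q = length P" "\<forall>xs\<in>set Q. mono_cyc c xs" "distinct (concat Q)"
      "A \<subseteq> set (concat Q)" "set (concat Q) \<subseteq> A \<union> B"
    by (elim exE conjE)
  have "A \<union> (set (concat Q) \<inter> B) = set (concat Q)" using Q(4,5) by blast
  then have "cycle_coverable (mono_cyc c) (A \<union> (set (concat Q) \<inter> B)) (2 * r^2)"
    unfolding cycle_coverable_def using Q P(4) by (intro exI[of _ Q]) simp
  then show ?thesis by (intro exI[of _ "set (concat Q) \<inter> B"]) simp
qed

section \<open>Monochromatic triangles and long monochromatic cycles\<close>

definition mono_set :: "('a set \<Rightarrow> 'b) \<Rightarrow> 'b \<Rightarrow> 'a set \<Rightarrow> bool" where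
  "mono_set c col t \<longleftrightarrow> (\<forall>e. e \<subseteq> t \<longrightarrow> card e = 2 \<longrightarrow> c e = col)"

lemma mono_set_triple:
  assumes "u \<noteq> v" "v \<noteq> w" "u \<noteq> w" "c {u, v} = col" "c {v, w} = col" "c {u, w} = col"
  shows "mono_set c col {u, v, w}"
  unfolding mono_set_def
proof (intro allI impI)
  fix e assume e: "e \<subseteq> {u, v, w}" "card e = 2"
  then obtain x y where "e = {x, y}" "x \<noteq> y" by (auto simp: card_2_iff)
  then show "c e = col" using e(1) assms by (auto simp: insert_commute)
qed

section \<open>A Ramsey bound for local colourings\<close>

text \<open>Room for one vertex and \<open>r + 1\<close> colour classes of the size required for
  \<open>r\<close>, as the induction step of the Ramsey bound demands.\<close>

lemma ramsey_recursion_bound: "(r + 1) * (r + 2) ^ (r + 1) + 1 \<le> (r + 3 :: nat) ^ (r + 2)"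
proof -
  define p where "p = (r + 2) ^ (r + 1)"
  define q where "q = (r + 3) ^ (r + 1)"
  have "1 \<le> p" unfolding p_def by (rule one_le_power) simp
  have "p \<le> q" unfolding p_def q_def by (intro power_mono) auto
  have "(r + 1) * p + 1 \<le> (r + 3) * p" using \<open>1 \<le> p\<close> by (simp add: algebra_simps)
  also have "\<dots> \<le> (r + 3) * q" using \<open>p \<le> q\<close> by (rule mult_left_mono) simp
  also have "\<dots> = (r + 3) ^ (r + 2)" unfolding q_def by simp
  finally show ?thesis unfolding p_def .
qed

text \<open>Induction on \<open>r\<close>: take the neighbourhood of a vertex \<open>v\<close> in a
  popular colour. Either it contains an edge of that colour, which closes a triangle with
  \<open>v\<close>, or the colour is absent inside it and one colour per vertex is saved. For
  \<open>r = 0\<close> two vertices already contradict local colouring.\<close>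

lemma local_ramsey_triangle:
  "finite V \<Longrightarrow> locally_coloured r V c \<Longrightarrow> (r + 2) ^ (r + 1) \<le> card V \<Longrightarrow>
    \<exists>t col. t \<subseteq> V \<and> card t = 3 \<and> mono_set c col t"
proof (induction r arbitrary: V)
  case 0
  then have "2 \<le> card V" by simp
  then obtain S where S: "S \<subseteq> V" "card S = 2" by (metis obtain_subset_with_card_n)
  then obtain u v where uv: "u \<in> V" "v \<in> V" "u \<noteq> v" by (auto simp: card_2_iff)
  then have "card ((\<lambda>w. c {u, w}) ` (V - {u})) > 0" using 0(1) by (auto simp: card_gt_0_iff)
  then show ?case using 0(2) uv by (auto simp: locally_coloured_def)
next
  case (Suc r)
  have p: "(r + 3) ^ (r + 2) \<le> card V" using Suc.prems(3) by (simp add: numeral_eq_Suc)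
  have cV: "(r + 1) * (r + 2) ^ (r + 1) + 1 \<le> card V"
    using ramsey_recursion_bound[of r] p by linarith
  then have "card V > 0" by linarith
  then obtain v where v: "v \<in> V" by (auto simp: card_gt_0_iff)
  let ?S = "V - {v}"
  have cS: "(r + 1) * (r + 2) ^ (r + 1) \<le> card ?S" using cV v Suc.prems(1) by simp
  have "(0::nat) < (r + 1) * (r + 2) ^ (r + 1)" by simp
  then have "0 < card ?S" using cS by linarith
  then have "?S \<noteq> {}" by (metis card.empty less_irrefl)
  moreover have "finite ?S" "card ((\<lambda>w. c {v, w}) ` ?S) \<le> Suc r"
    using Suc.prems(1,2) v by (auto simp: locally_coloured_def)
  ultimately obtain col where col: "card ?S \<le> Suc r * card {w \<in> ?S. c {v, w} = col}"
    using popular_value[of ?S "\<lambda>w. c {v, w}" "Suc r"] by blast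
  let ?N = "{w \<in> ?S. c {v, w} = col}"
  show ?case
  proof (cases "\<exists>u\<in>?N. \<exists>w\<in>?N. u \<noteq> w \<and> c {u, w} = col")
    case True
    then obtain u w where uw: "u \<in> ?N" "w \<in> ?N" "u \<noteq> w" "c {u, w} = col" by blast
    then have "mono_set c col {v, u, w}" by (intro mono_set_triple) auto
    moreover have "{v, u, w} \<subseteq> V" "card {v, u, w} = 3" using uw v by auto
    ultimately show ?thesis by blast
  next
    case False
    then have ncol: "\<And>u w. u \<in> ?N \<Longrightarrow> w \<in> ?N \<Longrightarrow> w \<noteq> u \<Longrightarrow> c {w, u} \<noteq> col"
      by (metis (no_types, lifting))
    have "locally_coloured r ?N c" unfolding locally_coloured_def
    proof
      fix w assume w: "w \<in> ?N"
      let ?C = "(\<lambda>u. c {w, u}) ` (V - {w})"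
      have "c {w, v} = col" using w by (simp add: insert_commute)
      \<comment> \<open>Each \<open>w\<close> sees \<open>col\<close> on its edge to
        \<open>v\<close> but nowhere inside \<open>?N\<close>, so passing to \<open>?N\<close> loses
        a colour at \<open>w\<close>.\<close>
      then have colC: "col \<in> ?C" using w v by blast
      have "card ((\<lambda>u. c {w, u}) ` (?N - {w})) \<le> card (?C - {col})"
      proof (intro card_mono subsetI)
        fix x assume "x \<in> (\<lambda>u. c {w, u}) ` (?N - {w})"
        then obtain u where u: "u \<in> ?N" "u \<noteq> w" "x = c {w, u}" by blast
        then have "x \<noteq> col" using ncol[OF u(1) w] by simp
        then show "x \<in> ?C - {col}" using u by blast
      qed (use Suc.prems(1) in simp)
      also have "\<dots> = card ?C - 1" using colC by (rule card_Diff_singleton)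
      also have "card ?C \<le> Suc r" using Suc.prems(2) w unfolding locally_coloured_def by blast
      then have "card ?C - 1 \<le> r" by simp
      finally show "card ((\<lambda>u. c {w, u}) ` (?N - {w})) \<le> r" .
    qed
    moreover have "(r + 2) ^ (r + 1) \<le> card ?N"
    proof -
      have "(r + 1) * (r + 2) ^ (r + 1) \<le> (r + 1) * card ?N" using cS col by simp
      then show ?thesis by (simp only: mult_le_cancel1)
    qed
    ultimately have "\<exists>t col. t \<subseteq> ?N \<and> card t = 3 \<and> mono_set c col t"
      using Suc.prems(1) by (intro Suc.IH) auto
    then show ?thesis by blast
  qed
qed

section \<open>Supersaturation and the absorbing cycle\<close>

text \<open>Every set of \<open>R\<close> vertices contains a triple of \<open>T\<close>, while a
  triple lies in at most \<open>(card V - 3) choose (R - 3)\<close> such sets; count the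
  pairs.\<close>

lemma supersaturation_triples:
  assumes V: "finite V" "3 \<le> R" "R \<le> card V"
    and T: "\<And>t. t \<in> T \<Longrightarrow> t \<subseteq> V \<and> card t = 3"
    and hit: "\<And>S. S \<subseteq> V \<Longrightarrow> card S = R \<Longrightarrow> \<exists>t\<in>T. t \<subseteq> S"
  shows "(card V choose 3) \<le> card T * (R choose 3)"
proof -
  let ?n = "card V" and ?X = "\<lambda>t. {S. t \<subseteq> S \<and> S \<subseteq> V \<and> card S = R}"
  have "T \<subseteq> Pow V" using T by auto
  then have finT: "finite T" using V(1) finite_subset by blast
  have "?n choose R = card {S. S \<subseteq> V \<and> card S = R}" using n_subsets[OF V(1)] by simp
  also have "\<dots> \<le> card (\<Union>t\<in>T. ?X t)"
  proof (rule card_mono)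
    have "(\<Union>t\<in>T. ?X t) \<subseteq> Pow V" by auto
    then show "finite (\<Union>t\<in>T. ?X t)" using V(1) by (meson finite_Pow_iff finite_subset)
    show "{S. S \<subseteq> V \<and> card S = R} \<subseteq> (\<Union>t\<in>T. ?X t)" using hit by blast
  qed
  also have "\<dots> \<le> (\<Sum>t\<in>T. card (?X t))" by (rule card_UN_le[OF finT])
  also have "\<dots> \<le> of_nat (card T) * ((?n - 3) choose (R - 3))"
  proof (rule sum_bounded_above)
    fix t assume t: "t \<in> T"
    then have t': "t \<subseteq> V" "card t = 3" "finite t" using T V(1) finite_subset by blast+
    let ?U = "{U. U \<subseteq> V - t \<and> card U = R - 3}"
    have "finite ?U" by (rule finite_subset[of _ "Pow V"]) (use V(1) in auto)
    moreover have "?X t \<subseteq> (\<lambda>U. t \<union> U) ` ?U"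
    proof
      fix S assume S: "S \<in> ?X t"
      then have "S = t \<union> (S - t)" "S - t \<subseteq> V - t" "card (S - t) = R - 3"
        using t' card_Diff_subset[of t S] by auto
      then show "S \<in> (\<lambda>U. t \<union> U) ` ?U" by blast
    qed
    ultimately have "card (?X t) \<le> card ?U" by (rule surj_card_le)
    also have "\<dots> = card (V - t) choose (R - 3)" using V(1) by (intro n_subsets) auto
    also have "card (V - t) = ?n - 3" using t' by (simp add: card_Diff_subset)
    finally show "card (?X t) \<le> (?n - 3) choose (R - 3)" .
  qed
  finally have "(?n choose R) * (R choose 3) \<le> card T * ((?n - 3) choose (R - 3)) * (R choose 3)"
    by simp
  \<comment> \<open>Both ways of choosing a triple inside an \<open>R\<close>-set agree, which
    exposes a common factor to cancel.\<close>
  then have "((?n - 3) choose (R - 3)) * (?n choose 3) \<le> ((?n - 3) choose (R - 3)) * (card T * (R choose 3))"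
    using choose_mult[OF V(2,3)] by (simp add: algebra_simps)
  moreover have "0 < (?n - 3) choose (R - 3)" using V by simp
  ultimately show ?thesis by simp
qed

definition colour_edges :: "('a set \<Rightarrow> 'b) \<Rightarrow> 'a set \<Rightarrow> 'b \<Rightarrow> 'a set set" where
  "colour_edges c V col = {e. e \<subseteq> V \<and> card e = 2 \<and> c e = col}"

lemma finite_colour_edges: "finite V \<Longrightarrow> finite (colour_edges c V col)"
  by (rule finite_subset[of _ "Pow V"]) (auto simp: colour_edges_def)

lemma sum_card_colour_edges:
  assumes "finite V"
  shows "(\<Sum>col\<in>c ` {e. e \<subseteq> V \<and> card e = 2}. card (colour_edges c V col)) = card V choose 2"
proof -
  have "finite {e. e \<subseteq> V \<and> card e = 2}"
    by (rule finite_subset[of _ "Pow V"]) (use assms in auto)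
  from sum.image_gen[OF this, of "\<lambda>_. 1::nat" c] show ?thesis
    using n_subsets[OF assms, of 2] by (simp add: colour_edges_def conj_assoc)
qed

lemma is_cycle_mono:
  assumes "is_cycle E xs" "\<And>u v. E u v \<Longrightarrow> E' u v"
  shows "is_cycle E' xs"
  using assms successively_mono[of E xs E'] by (auto simp: is_cycle_def)

text \<open>By supersaturation some colour has more than \<open>k\<close> triangles per edge on
  average. Its dense core is a triangle system with every used pair in more than \<open>k\<close>
  triangles, to which the tight path argument applies.\<close>

lemma exists_absorber:
  assumes V: "finite V" "3 \<le> R" "R ^ 3 \<le> card V"
    and hit: "\<And>S. S \<subseteq> V \<Longrightarrow> card S = R \<Longrightarrow> \<exists>t col. t \<subseteq> S \<and> card t = 3 \<and> mono_set c col t"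
  obtains Z B where "Z \<inter> B = {}" "Z \<union> B \<subseteq> V" "card V \<le> 4 * R ^ 3 * card B"
    "\<And>B'. B' \<subseteq> B \<Longrightarrow> \<exists>xs. mono_cyc c xs \<and> set xs = Z \<union> (B - B')"
proof -
  let ?n = "card V"
  \<comment> \<open>Chosen so that \<open>k * R ^ 3 \<le> ?n\<close>, which is what contradicts the
    triangle count below.\<close>
  define k where "k = ?n div R ^ 3"
  let ?K = "c ` {e. e \<subseteq> V \<and> card e = 2}"
  let ?P = "colour_edges c V"
  define Tc where "Tc col = {t. t \<subseteq> V \<and> card t = 3 \<and> mono_set c col t}" for col
  have finK: "finite ?K" by (rule finite_imageI, rule finite_subset[of _ "Pow V"]) (use V in auto)
  have finTc: "finite (Tc col)" for col
    by (rule finite_subset[of _ "Pow V"]) (use V in \<open>auto simp: Tc_def\<close>)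
  have R0: "0 < R" "27 \<le> R ^ 3" using V(2) power_mono[of 3 R 3] by auto
  have "R * 1 \<le> R * R^2" using R0 by (intro mult_left_mono) auto
  then have "R \<le> R ^ 3" by (simp add: power3_eq_cube power2_eq_square)
  then have Rn: "R \<le> ?n" using V(3) by linarith
  have "\<exists>col\<in>?K. k * card (?P col) < card (Tc col)"
  proof (rule ccontr)
    assume "\<not> ?thesis"
    then have le: "card (Tc col) \<le> k * card (?P col)" if "col \<in> ?K" for col using that by force
    let ?T = "\<Union>col\<in>?K. Tc col"
    have "?n choose 3 \<le> card ?T * (R choose 3)"
    proof (rule supersaturation_triples[OF V(1,2) Rn])
      show "t \<subseteq> V \<and> card t = 3" if "t \<in> ?T" for t using that by (auto simp: Tc_def)
      fix S assume S: "S \<subseteq> V" "card S = R"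
      then obtain t col where t: "t \<subseteq> S" "card t = 3" "mono_set c col t" using hit by blast
      \<comment> \<open>\<open>?K\<close> holds only the colours that occur on edges; an edge of
        \<open>t\<close> certifies that the colour of \<open>t\<close> is among them.\<close>
      obtain e where e: "e \<subseteq> t" "card e = 2"
        by (rule obtain_subset_with_card_n[of 2 t]) (use t(2) in simp_all)
      have "c e = col" using t(3) e unfolding mono_set_def by simp
      moreover have "e \<subseteq> V" "t \<subseteq> V" using e(1) t(1) S(1) by simp_all
      ultimately have "col \<in> ?K" "t \<in> Tc col" using t e unfolding Tc_def by blast+
      then show "\<exists>t\<in>?T. t \<subseteq> S" using t(1) by blast
    qed
    also have "card ?T \<le> (\<Sum>col\<in>?K. card (Tc col))" by (rule card_UN_le[OF finK])
    also have "\<dots> \<le> (\<Sum>col\<in>?K. k * card (?P col))" by (intro sum_mono le)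
    also have "\<dots> = k * (?n choose 2)"
      by (simp add: sum_card_colour_edges[OF V(1)] flip: sum_distrib_left)
    finally have "?n choose 3 \<le> k * (?n choose 2) * (R choose 3)" by simp
    \<comment> \<open>The factor 6 allows replacing \<open>6 * (R choose 3)\<close> by
      \<open>R ^ 3\<close>. Comparison with
      \<open>3 * (?n choose 3) = (?n choose 2) * (?n - 2)\<close> will leave
      \<open>2 * (?n - 2) \<le> ?n\<close>, impossible for \<open>?n \<ge> 27\<close>.\<close>
    then have "6 * (?n choose 3) \<le> k * (?n choose 2) * (6 * (R choose 3))" by simp
    also have "6 * (R choose 3) \<le> R ^ 3" using binomial_fact_pow[of R 3] by (simp add: fact_numeral mult.commute)
    also have "k * (?n choose 2) * R ^ 3 = (?n choose 2) * (k * R ^ 3)" by simp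
    also have "k * R ^ 3 \<le> ?n" by (simp add: k_def)
    finally have "2 * (3 * (?n choose 3)) \<le> (?n choose 2) * ?n" by simp
    moreover have "(?n choose 3) * (3 choose 2) = (?n choose 2) * ((?n - 2) choose (3 - 2))"
      using R0 V(3) by (intro choose_mult) auto
    then have "3 * (?n choose 3) = (?n choose 2) * (?n - 2)" by (simp add: numeral_eq_Suc)
    ultimately have "(?n choose 2) * (2 * (?n - 2)) \<le> (?n choose 2) * ?n" by simp
    moreover have "0 < ?n choose 2" using R0 V(3) by (intro zero_less_binomial) auto
    ultimately have "2 * (?n - 2) \<le> ?n" by simp
    then show False using R0 V(3) by simp
  qed
  then obtain col where col: "k * card (?P col) < card (Tc col)" by blast
  let ?f = "\<lambda>t. {e. e \<subseteq> t \<and> card e = 2}"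
  have "\<exists>T'. T' \<subseteq> Tc col \<and> T' \<noteq> {} \<and> (\<forall>t\<in>T'. \<forall>s\<in>?f t. k < card {u \<in> T'. s \<in> ?f u})"
  proof (rule exists_dense_core[where f = ?f, OF finite_colour_edges[OF V(1)] finTc _ col])
    show "?f t \<subseteq> ?P col" if "t \<in> Tc col" for t
      using that by (auto simp: Tc_def colour_edges_def mono_set_def)
  qed
  then obtain T where T: "T \<subseteq> Tc col" "T \<noteq> {}"
    "\<forall>t\<in>T. \<forall>s\<in>?f t. k < card {u \<in> T. s \<in> ?f u}" by (elim exE conjE)
  have Tm: "t \<subseteq> V" "card t = 3" "mono_set c col t" if "t \<in> T" for t
    using that T(1) by (auto simp: Tc_def)
  have E: "c {u, v} = col" if "t \<in> T" "u \<in> t" "v \<in> t" "u \<noteq> v" for t u v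
    using Tm(3)[OF that(1)] that by (auto simp: mono_set_def)
  have deg: "k < card {t' \<in> T. {u, v} \<subseteq> t'}" if "t \<in> T" "u \<in> t" "v \<in> t" "u \<noteq> v" for t u v
    using bspec[OF bspec[OF T(3) that(1)], of "{u, v}"] that by simp
  obtain Z B where ZB: "Z \<inter> B = {}" "Z \<union> B \<subseteq> \<Union>T" "k \<le> 2 * card B"
    "\<And>B'. B' \<subseteq> B \<Longrightarrow> \<exists>xs. is_cycle (\<lambda>u v. c {u, v} = col) xs \<and> set xs = Z \<union> (B - B')"
    by (rule tight_path_absorber[of T "\<lambda>u v. c {u, v} = col" k,
        OF E finite_subset[OF T(1) finTc] T(2) Tm(2) deg]) (assumption | rule that)+
  show thesis
  proof (rule that[OF ZB(1)])
    show "Z \<union> B \<subseteq> V" using ZB(2) Tm(1) by blast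
    \<comment> \<open>Positivity of \<open>k\<close> lets the remainder of the division be absorbed
      by doubling \<open>k * R ^ 3\<close>.\<close>
    have "1 \<le> k" using V(3) R0 by (simp add: k_def div_greater_zero_iff Suc_le_eq)
    have "?n = k * R ^ 3 + ?n mod R ^ 3" by (simp only: k_def div_mult_mod_eq)
    also have "?n mod R ^ 3 \<le> 1 * R ^ 3" using R0 by (simp add: less_imp_le)
    also have "k * R ^ 3 + 1 * R ^ 3 \<le> k * R ^ 3 + k * R ^ 3"
      using \<open>1 \<le> k\<close> by (intro add_left_mono mult_right_mono) auto
    also have "\<dots> = (2 * R ^ 3) * k" by simp
    also have "\<dots> \<le> (2 * R ^ 3) * (2 * card B)" using ZB(3) by (intro mult_left_mono) auto
    finally show "?n \<le> 4 * R ^ 3 * card B" by simp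
    show "\<exists>xs. mono_cyc c xs \<and> set xs = Z \<union> (B - B')" if "B' \<subseteq> B" for B'
      using ZB(4)[OF that] by (auto simp: mono_cyc_def)
  qed
qed

section \<open>Long monochromatic cycles\<close>

text \<open>Each vertex sees at most \<open>r\<close> colours, so the sets \<open>Vc col\<close>
  have total size at most \<open>r * card V\<close>. Averaging the edges over them gives a colour
  with a core of minimum degree above \<open>k\<close>, hence a long cycle, however many colours
  occur in all.\<close>

lemma exists_long_mono_cycle:
  assumes V: "finite V" "V \<noteq> {}" "locally_coloured r V c" and r: "0 < r"
  shows "\<exists>xs. mono_cyc c xs \<and> set xs \<subseteq> V \<and> card V \<le> 2 * r * length xs"
proof (cases "card V \<ge> 2")
  case False
  obtain v where "v \<in> V" using V by blast
  moreover have "card V \<le> 2 * r" using False r by linarith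
  ultimately show ?thesis by (intro exI[of _ "[v]"]) (auto simp: mono_cyc_def is_cycle_def)
next
  case True
  let ?n = "card V"
  \<comment> \<open>With \<open>?n - 2\<close> the failed average would give
    \<open>?n * (?n - 1) \<le> ?n * (?n - 2)\<close>, a contradiction.\<close>
  define k where "k = (?n - 2) div (2 * r)"
  let ?K = "c ` {e. e \<subseteq> V \<and> card e = 2}"
  let ?P = "colour_edges c V"
  define Vc where "Vc col = {v \<in> V. \<exists>w\<in>V - {v}. c {v, w} = col}" for col
  have finK: "finite ?K" by (rule finite_imageI, rule finite_subset[of _ "Pow V"]) (use V in auto)
  have k2: "k * (2 * r) \<le> ?n - 2" by (simp add: k_def)
  have "\<exists>col\<in>?K. k * card (Vc col) < card (?P col)"
  proof (rule ccontr)
    assume "\<not> ?thesis"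
    then have le: "card (?P col) \<le> k * card (Vc col)" if "col \<in> ?K" for col using that by force
    have "?n choose 2 = (\<Sum>col\<in>?K. card (?P col))" by (simp add: sum_card_colour_edges[OF V(1)])
    also have "\<dots> \<le> (\<Sum>col\<in>?K. k * card (Vc col))" by (intro sum_mono le)
    also have "\<dots> = k * (\<Sum>col\<in>?K. card (Vc col))" by (simp add: sum_distrib_left)
    also have "(\<Sum>col\<in>?K. card (Vc col)) = (\<Sum>v\<in>V. card {col \<in> ?K. \<exists>w\<in>V - {v}. c {v, w} = col})"
      unfolding Vc_def using V(1) finK by (intro sum_multicount_gen) auto
    also have "\<dots> \<le> (\<Sum>v\<in>V. r)"
    proof (intro sum_mono)
      fix v assume v: "v \<in> V"
      have "card {col \<in> ?K. \<exists>w\<in>V - {v}. c {v, w} = col} \<le> card ((\<lambda>w. c {v, w}) ` (V - {v}))"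
      proof (intro card_mono subsetI)
        fix col assume "col \<in> {col \<in> ?K. \<exists>w\<in>V - {v}. c {v, w} = col}"
        then obtain w where "w \<in> V - {v}" "c {v, w} = col" by blast
        then show "col \<in> (\<lambda>w. c {v, w}) ` (V - {v})" by blast
      qed (use V(1) in simp)
      also have "\<dots> \<le> r" using V(3) v by (simp add: locally_coloured_def)
      finally show "card {col \<in> ?K. \<exists>w\<in>V - {v}. c {v, w} = col} \<le> r" .
    qed
    finally have "2 * (?n choose 2) \<le> (k * (2 * r)) * ?n" by (simp add: mult_ac)
    also have "\<dots> \<le> (?n - 2) * ?n" using k2 by (intro mult_right_mono) auto
    finally have "?n * (?n - 1) \<le> ?n * (?n - 2)"
      using times_binomial_minus1_eq[of 2 ?n] by (simp add: mult.commute)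
    then show False using True by simp
  qed
  then obtain col where col: "k * card (Vc col) < card (?P col)" by blast
  have VcI: "e \<subseteq> Vc col" if "e \<in> ?P col" for e
  proof -
    obtain u v where uv: "e = {u, v}" "u \<noteq> v" using \<open>e \<in> ?P col\<close>
      by (auto simp: colour_edges_def card_2_iff)
    have "u \<in> V" "v \<in> V" "c {u, v} = col" using that uv by (auto simp: colour_edges_def)
    moreover from this have "c {v, u} = col" by (simp add: insert_commute)
    ultimately have "u \<in> Vc col" "v \<in> Vc col" using uv(2) unfolding Vc_def by blast+
    then show ?thesis using uv(1) by simp
  qed
  have "finite (Vc col)" using V(1) by (simp add: Vc_def)
  from exists_dense_core[where f = "\<lambda>e. e" and S = "Vc col" and T = "?P col" and k = k,
      OF this finite_colour_edges[OF V(1)] VcI col]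
  have "\<exists>T. T \<subseteq> ?P col \<and> T \<noteq> {} \<and> (\<forall>t\<in>T. \<forall>s\<in>t. k < card {u \<in> T. s \<in> u})" .
  then obtain T where T: "T \<subseteq> ?P col" "T \<noteq> {}" "\<forall>t\<in>T. \<forall>s\<in>t. k < card {u \<in> T. s \<in> u}"
    by blast
  have "finite T" by (rule finite_subset[OF T(1) finite_colour_edges[OF V(1)]])
  moreover have "card t = 2" if "t \<in> T" for t using T(1) that by (auto simp: colour_edges_def)
  moreover have "k < card {u \<in> T. s \<in> u}" if "t \<in> T" "s \<in> t" for t s using T(3) that by blast
  ultimately obtain xs where xs: "is_cycle (\<lambda>u v. {u, v} \<in> T) xs" "set xs \<subseteq> \<Union>T" "k + 2 \<le> length xs"
    using long_cycle_of_min_degree[of T k] T(2) by blast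
  have "mono_cyc c xs" unfolding mono_cyc_def
    using is_cycle_mono[OF xs(1), of "\<lambda>u v. c {u, v} = col"] T(1) by (auto simp: colour_edges_def)
  moreover have "set xs \<subseteq> V" using xs(2) T(1) by (auto simp: colour_edges_def)
  moreover have "?n \<le> 2 * r * length xs"
  proof -
    have "?n - 2 = k * (2 * r) + (?n - 2) mod (2 * r)" by (simp only: k_def div_mult_mod_eq)
    also have "\<dots> < k * (2 * r) + 2 * r" using r by simp
    \<comment> \<open>The rounding loss and the subtracted 2 each cost at most \<open>2 * r\<close>,
      paid for by the two extra vertices of the cycle.\<close>
    finally have "?n \<le> k * (2 * r) + 2 * (2 * r)" using r by linarith
    also have "\<dots> = 2 * r * (k + 2)" by (simp add: algebra_simps)
    also have "\<dots> \<le> 2 * r * length xs" using xs(3) by (intro mult_left_mono) auto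
    finally show ?thesis .
  qed
  ultimately show ?thesis by blast
qed

section \<open>The cycle partition\<close>

text \<open>Each step removes a cycle through at least a fraction \<open>1 / (2 * r)\<close> of the
  remaining set \<open>W\<close>; subsets inherit the local colouring. Once \<open>W\<close> is
  empty, further steps change nothing.\<close>

lemma greedy_cycles:
  assumes V: "finite V" "locally_coloured r V c" and r: "0 < r"
  shows "\<exists>W\<subseteq>V. cycle_coverable (mono_cyc c) (V - W) s \<and>
    real (card W) \<le> (1 - 1 / (2 * real r)) ^ s * real (card V)"
proof (induction s)
  case 0
  show ?case by (intro exI[of _ V]) (simp add: cycle_coverable_empty)
next
  case (Suc s)
  let ?q = "1 - 1 / (2 * real r)"
  have q: "0 \<le> ?q" using r by simp
  obtain W where W: "W \<subseteq> V" "cycle_coverable (mono_cyc c) (V - W) s"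
    "real (card W) \<le> ?q ^ s * real (card V)" using Suc.IH by blast
  show ?case
  proof (cases "W = {}")
    case True
    have "0 \<le> ?q ^ Suc s * real (card V)"
      by (intro mult_nonneg_nonneg zero_le_power q) simp
    moreover have "cycle_coverable (mono_cyc c) (V - W) (Suc s)"
      by (rule cycle_coverable_mono[OF W(2)]) auto
    ultimately show ?thesis using True by (intro exI[of _ W]) simp
  next
    case False
    have finW: "finite W" using W(1) V(1) finite_subset by blast
    obtain xs where xs: "mono_cyc c xs" "set xs \<subseteq> W" "card W \<le> 2 * r * length xs"
      using exists_long_mono_cycle[OF finW False locally_coloured_subset[OF V(2) W(1) V(1)] r]
      by blast
    have d: "distinct xs" using xs(1) by (auto simp: mono_cyc_def is_cycle_def)
    have "cycle_coverable (mono_cyc c) ((V - W) \<union> set xs) (s + 1)"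
      using xs(2) by (intro cycle_coverable_Un[OF W(2) cycle_coverable_single[of "mono_cyc c", OF xs(1) d]]) blast
    moreover have "(V - W) \<union> set xs = V - (W - set xs)" using W(1) xs(2) by blast
    ultimately have "cycle_coverable (mono_cyc c) (V - (W - set xs)) (Suc s)" by simp
    moreover have "real (card (W - set xs)) \<le> ?q ^ Suc s * real (card V)"
    proof -
      have "length xs \<le> card W" using card_mono[OF finW xs(2)] d by (simp add: distinct_card)
      then have "real (card (W - set xs)) = real (card W) - real (length xs)"
        using xs(2) d by (simp add: card_Diff_subset distinct_card of_nat_diff)
      also have "real (card W) \<le> 2 * real r * real (length xs)"
        using xs(3) by (metis (mono_tags) of_nat_le_iff of_nat_mult of_nat_numeral)
      then have "real (card W) / (2 * real r) \<le> real (length xs)"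
        using r by (simp add: field_simps)
      then have "real (card W) - real (length xs) \<le> ?q * real (card W)"
        by (simp add: algebra_simps)
      also have "\<dots> \<le> ?q * (?q ^ s * real (card V))" by (rule mult_left_mono[OF W(3) q])
      finally show ?thesis by simp
    qed
    ultimately show ?thesis using W(1) by (intro exI[of _ "W - set xs"]) blast
  qed
qed

text \<open>The power is at most \<open>exp (- s / (2 * r))\<close>, which is at most
  \<open>r\<close> to the power \<open>- 12 * r\<close>. The other factor is at most
  \<open>r ^ (6 * r + 12)\<close>, by \<open>16 \<le> r ^ 4\<close> and
  \<open>r + 2 \<le> r ^ 2\<close>.\<close>

lemma leftover_bound:
  fixes r s :: nat
  assumes r: "2 \<le> r" and s: "24 * real r ^ 2 * ln (real r) \<le> real s"
  shows "(1 - 1 / (2 * real r)) ^ s * (16 * real r ^ 2 * (real (r + 2) ^ (r + 1)) ^ 3) \<le> 1"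
proof -
  let ?x = "1 / (2 * real r)"
  have "(1 - ?x) ^ s \<le> exp (- ?x) ^ s"
    using r exp_ge_add_one_self[of "- ?x"] by (intro power_mono) auto
  also have "\<dots> = exp (- (real s * ?x))" by (simp flip: exp_of_nat_mult)
  also have "\<dots> \<le> exp (- (real (12 * r) * ln (real r)))"
  proof -
    have "real (12 * r) * ln (real r) = 24 * real r ^ 2 * ln (real r) * ?x"
      using r by (simp add: power2_eq_square)
    also have "\<dots> \<le> real s * ?x" by (rule mult_right_mono[OF s]) simp
    finally show ?thesis by simp
  qed
  also have "\<dots> = inverse (real r ^ (12 * r))"
    using r by (simp only: exp_minus exp_of_nat_mult) simp
  finally have 1: "(1 - ?x) ^ s \<le> inverse (real r ^ (12 * r))" .
  have r1: "1 \<le> real r" using r by simp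
  have "(2::real) ^ 4 \<le> real r ^ 4" using r by (intro power_mono) auto
  then have "16 \<le> real r ^ 4" by simp
  moreover have "(real (r + 2) ^ (r + 1)) ^ 3 \<le> real r ^ (6 * r + 6)"
  proof -
    have "r * 2 \<le> r * r" using r by (intro mult_left_mono) auto
    then have "r + 2 \<le> r ^ 2" using r unfolding power2_eq_square by linarith
    then have "real (r + 2) \<le> real (r ^ 2)" by (simp only: of_nat_le_iff)
    then have "real (r + 2) \<le> real r ^ 2" by (simp only: of_nat_power)
    then have "(real (r + 2) ^ (r + 1)) ^ 3 \<le> ((real r ^ 2) ^ (r + 1)) ^ 3"
      by (intro power_mono) auto
    also have "\<dots> = real r ^ (2 * (r + 1) * 3)" by (simp only: power_mult)
    also have "2 * (r + 1) * 3 = 6 * r + 6" by simp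
    finally show ?thesis .
  qed
  ultimately have "16 * real r ^ 2 * (real (r + 2) ^ (r + 1)) ^ 3
      \<le> real r ^ 4 * real r ^ 2 * real r ^ (6 * r + 6)"
    by (intro mult_mono) auto
  also have "\<dots> = real r ^ (4 + 2 + (6 * r + 6))" by (simp only: power_add)
  \<comment> \<open>The exponents compare because \<open>6 * r + 12 \<le> 12 * r\<close> for
    \<open>r \<ge> 2\<close>; this fixes the constant 24 for \<open>s\<close>.\<close>
  also have "\<dots> \<le> real r ^ (12 * r)" using r r1 by (intro power_increasing) auto
  finally have 2: "16 * real r ^ 2 * (real (r + 2) ^ (r + 1)) ^ 3 \<le> real r ^ (12 * r)" .
  have "(1 - ?x) ^ s * (16 * real r ^ 2 * (real (r + 2) ^ (r + 1)) ^ 3)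
      \<le> inverse (real r ^ (12 * r)) * real r ^ (12 * r)"
    using 1 2 by (rule mult_mono) auto
  also have "\<dots> = 1" using r by simp
  finally show ?thesis .
qed

text \<open>The absorber is set aside first: it stays a cycle after losing any vertices of
  \<open>B\<close>, so the final cover may use them freely. The three summands count the greedy
  cycles, the cover of the leftover and the absorbing cycle.\<close>

lemma locally_coloured_cycle_partition:
  assumes V: "finite V" "locally_coloured r V c" and r: "2 \<le> r"
    and s: "24 * real r ^ 2 * ln (real r) \<le> real s"
  shows "cycle_coverable (mono_cyc c) V (s + 2 * r^2 + 1)"
proof -
  define R where "R = (r + 2) ^ (r + 1)"
  let ?q = "(1 - 1 / (2 * real r)) ^ s"
  have "(1::nat) \<le> (r + 2) ^ r" by (rule one_le_power) simp
  then have "(r + 2) * 1 \<le> (r + 2) * (r + 2) ^ r" by (rule mult_left_mono) simp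
  then have R3: "3 \<le> R" using r by (simp add: R_def)
  \<comment> \<open>The factor is the product of \<open>4 * R ^ 3\<close>, the loss from
    \<open>V\<close> to the reservoir, and \<open>4 * r^2\<close>, the ratio demanded by the
    bipartite cover.\<close>
  have left: "16 * r^2 * R ^ 3 * card W \<le> m"
    if "real (card W) \<le> ?q * real m" for W m
  proof -
    have "real (16 * r^2 * R ^ 3 * card W) = (16 * real r ^ 2 * real R ^ 3) * real (card W)" by simp
    also have "\<dots> \<le> (16 * real r ^ 2 * real R ^ 3) * (?q * real m)"
      by (rule mult_left_mono[OF that]) simp
    also have "\<dots> = (?q * (16 * real r ^ 2 * real R ^ 3)) * real m" by simp
    also have "\<dots> \<le> 1 * real m"
    proof (rule mult_right_mono)
      show "?q * (16 * real r ^ 2 * real R ^ 3) \<le> 1"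
        using leftover_bound[OF r s] by (simp only: R_def of_nat_power)
    qed simp
    finally show ?thesis by (simp only: of_nat_le_iff mult_1)
  qed
  have r0: "0 < r" using r by simp
  show ?thesis
  proof (cases "R ^ 3 \<le> card V")
    case False
    \<comment> \<open>With fewer than \<open>R ^ 3\<close> vertices the greedy cycles alone suffice,
      since even one leftover vertex would exceed the bound \<open>left\<close>.\<close>
    obtain W where W: "W \<subseteq> V" "cycle_coverable (mono_cyc c) (V - W) s"
      "real (card W) \<le> ?q * real (card V)" using greedy_cycles[OF V r0] by blast
    have "W = {}"
    proof (rule ccontr)
      assume "W \<noteq> {}"
      then have "1 \<le> card W" using W(1) V(1) by (simp add: Suc_le_eq card_gt_0_iff finite_subset)
      have "R ^ 3 * 1 \<le> R ^ 3 * (16 * r^2 * card W)"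
        using \<open>1 \<le> card W\<close> r by (intro mult_left_mono) (auto simp: Suc_le_eq)
      also have "\<dots> = 16 * r^2 * R ^ 3 * card W" by simp
      finally show False using left[OF W(3)] False by linarith
    qed
    then show ?thesis using cycle_coverable_mono[OF W(2)] by simp
  next
    case True
    obtain Z B where ZB: "Z \<inter> B = {}" "Z \<union> B \<subseteq> V" "card V \<le> 4 * R ^ 3 * card B"
      "\<And>B'. B' \<subseteq> B \<Longrightarrow> \<exists>xs. mono_cyc c xs \<and> set xs = Z \<union> (B - B')"
    proof (rule exists_absorber[OF V(1) R3 True])
      fix S assume S: "S \<subseteq> V" "card S = R"
      show "\<exists>t col. t \<subseteq> S \<and> card t = 3 \<and> mono_set c col t"
      proof (rule local_ramsey_triangle)
        show "finite S" using S(1) V(1) finite_subset by blast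
        show "locally_coloured r S c" by (rule locally_coloured_subset[OF V(2) S(1) V(1)])
        show "(r + 2) ^ (r + 1) \<le> card S" using S(2) by (simp add: R_def)
      qed
    qed (rule that)
    let ?V = "V - (Z \<union> B)"
    have "finite ?V" "locally_coloured r ?V c"
      using V(1) locally_coloured_subset[OF V(2) _ V(1), of ?V] by auto
    from greedy_cycles[OF this r0, of s]
    obtain W where W: "W \<subseteq> ?V" "cycle_coverable (mono_cyc c) (?V - W) s"
      "real (card W) \<le> ?q * real (card ?V)" by blast
    have "16 * r^2 * R ^ 3 * card W \<le> card ?V" by (rule left[OF W(3)])
    also have "\<dots> \<le> card V" using V(1) by (intro card_mono) auto
    also have "\<dots> \<le> 4 * R ^ 3 * card B" by (rule ZB(3))
    finally have "(4 * R ^ 3) * (4 * r^2 * card W) \<le> (4 * R ^ 3) * card B" by (simp add: mult_ac)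
    then have "4 * r^2 * card W \<le> card B" using R3 by (simp only: mult_le_cancel1) simp
    moreover have "W \<union> B \<subseteq> V" "W \<inter> B = {}" using W(1) ZB(2) by auto
    ultimately obtain B' where B': "B' \<subseteq> B" "cycle_coverable (mono_cyc c) (W \<union> B') (2 * r^2)"
      using cover_by_bipartite_cycles[OF V(1,2) _ _ r0, of W B] by blast
    \<comment> \<open>The absorbing cycle now gives up exactly the vertices \<open>B'\<close> that
      the cover of \<open>W\<close> consumed.\<close>
    obtain xs where xs: "mono_cyc c xs" "set xs = Z \<union> (B - B')" using ZB(4)[OF B'(1)] by blast
    have "distinct xs" using xs(1) by (auto simp: mono_cyc_def is_cycle_def)
    from cycle_coverable_single[of "mono_cyc c", OF xs(1) this]
    have c1: "cycle_coverable (mono_cyc c) (Z \<union> (B - B')) 1" by (simp only: xs(2))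
    have "cycle_coverable (mono_cyc c) (((?V - W) \<union> (W \<union> B')) \<union> (Z \<union> (B - B'))) (s + 2 * r^2 + 1)"
      using W(1) B'(1) ZB(1) by (intro cycle_coverable_Un W(2) B'(2) c1) blast+
    moreover have "((?V - W) \<union> (W \<union> B')) \<union> (Z \<union> (B - B')) = V"
      using W(1) B'(1) ZB(2) by blast
    ultimately show ?thesis by simp
  qed
qed

section \<open>Transfer to cyclic sequences and the final constant\<close>

lemma mono_cycle_of_mono_cyc:
  assumes "mono_cyc c xs" "set xs \<subseteq> {..<n}"
  shows "mono_cycle n c xs"
proof -
  obtain col where xs: "is_cycle (\<lambda>u v. c {u, v} = col) xs" using assms(1) by (auto simp: mono_cyc_def)
  have "c {xs ! i, xs ! ((i + 1) mod length xs)} = col" if i: "i < length xs" "2 \<le> length xs" for i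
  proof (cases "Suc i < length xs")
    case True
    then show ?thesis using xs by (auto simp: is_cycle_def successively_conv_nth)
  next
    case False
    \<comment> \<open>At the last index the modulus wraps round to 0, so the required edge is the
      closing one from \<open>last xs\<close> to \<open>hd xs\<close>.\<close>
    then have e: "length xs = Suc i" using i by simp
    then have "xs \<noteq> []" by auto
    then have "xs ! i = last xs" "xs ! 0 = hd xs" using e by (auto simp: last_conv_nth hd_conv_nth)
    then show ?thesis using xs i e by (auto simp: is_cycle_def)
  qed
  then show ?thesis using xs assms(2) by (auto simp: mono_cycle_def is_cycle_def)
qed

theorem theorem1p1:
  shows "\<exists>C::real. C > 0 \<and>
    (\<forall>(r::nat) (n::nat) (c :: nat set \<Rightarrow> nat).
       r \<ge> 2 \<longrightarrow> n \<ge> 1 \<longrightarrow> r_local_colouring r n c \<longrightarrow>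
       (\<exists>P. mono_cycle_partition n c P \<and>
            real (length P) \<le> C * real r ^ 2 * ln (real r)))"
\<comment> \<open>With \<open>L = r^2 * ln r\<close>, the constant 30 covers \<open>24 * L\<close>
  for the greedy steps, \<open>4 * L\<close> for \<open>2 * r^2\<close>, and \<open>2 * L\<close>
  for the rounding of \<open>s\<close> and the absorbing cycle.\<close>
proof (intro exI[of _ 30] conjI allI impI)
  fix r n :: nat and c :: "nat set \<Rightarrow> nat"
  assume r: "2 \<le> r" and c: "r_local_colouring r n c"
  define L where "L = real r ^ 2 * ln (real r)"
  \<comment> \<open>A lower bound on the logarithm is what lets \<open>r^2\<close> and the additive
    constants be absorbed into \<open>L\<close>.\<close>
  have ln2: "1 / 2 \<le> ln (real r)"
  proof -
    have "exp (1 / 2 :: real) ^ 2 = exp 1" by (simp flip: exp_of_nat_mult)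
    also have "\<dots> \<le> 2 ^ 2" using exp_le by simp
    finally have "exp (1 / 2 :: real) \<le> 2" by (rule power2_le_imp_le) simp
    then have "exp (1 / 2) \<le> real r" using r by simp
    then show ?thesis using r by (subst ln_ge_iff) auto
  qed
  have "real r ^ 2 * (1 / 2) \<le> L" unfolding L_def by (rule mult_left_mono[OF ln2]) simp
  moreover have "4 \<le> real r ^ 2" using r power_mono[of 2 "real r" 2] by simp
  ultimately have L: "2 * real r ^ 2 \<le> 4 * L" "2 \<le> L" by auto
  define s where "s = nat \<lceil>24 * L\<rceil>"
  have s: "24 * L \<le> real s" "real s \<le> 24 * L + 1" using L unfolding s_def by linarith+
  have "locally_coloured r {..<n} c" using c by (auto simp: locally_coloured_def r_local_colouring_def)
  then have "cycle_coverable (mono_cyc c) {..<n} (s + 2 * r^2 + 1)"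
    using s(1) r by (intro locally_coloured_cycle_partition) (auto simp: L_def)
  then obtain P where P: "\<forall>xs\<in>set P. mono_cyc c xs" "distinct (concat P)"
    "set (concat P) = {..<n}" "length P \<le> s + 2 * r^2 + 1"
    unfolding cycle_coverable_def by (elim exE conjE)
  have "mono_cycle n c xs" if "xs \<in> set P" for xs
    using that P(1,3) by (intro mono_cycle_of_mono_cyc) auto
  then have "mono_cycle_partition n c P" using P(2,3) by (simp add: mono_cycle_partition_def)
  moreover have "real (length P) \<le> real (s + 2 * r^2 + 1)" using P(4) by (simp only: of_nat_le_iff)
  then have "real (length P) \<le> 30 * L" using s(2) L by simp
  ultimately show "\<exists>P. mono_cycle_partition n c P \<and> real (length P) \<le> 30 * real r ^ 2 * ln (real r)"
    by (auto simp: L_def mult.assoc)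
qed simp

end
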